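(* Let $G$ be a graph with $n$ vertices and domination number $\gamma$, where $1 \leq \gamma \leq n-1$. For $0 \leq \alpha < 1$, $\rho_\alpha(G) \leq n - \gamma$, with equality if and only if either $G \cong K_{n-\gamma+1} \cup (\gamma-1)K_1$, or $\gamma \geq 2$, $n-\gamma$ is even and $G \cong \overline{\tfrac{n-\gamma+2}{2}K_2} \cup (\gamma-2)K_1$.
   Context: All graphs are finite, simple and undirected. For a graph $G$, $A(G)$ is its adjacency matrix and $D(G)$ the diagonal matrix of vertex degrees. For $\alpha\in[0,1]$, $A_\alpha(G) = \alpha D(G) + (1-\alpha)A(G)$, and $\rho_\alpha(G)$ is the largest eigenvalue of $A_\alpha(G)$ (the graph need not be connected). A dominating set of $G$ is a vertex set $S$ such that every vertex outside $S$ is adjacent to some vertex of $S$; the domination number is the minimum size of a dominating set. $K_s$ is the complete graph on $s$ vertices, $tK_2$ is the disjoint union of $t$ edges, $\overline{H}$ denotes the complement of $H$, $\cup$ denotes disjoint union, and $(\gamma-1)K_1$ denotes $\gamma-1$ isolated vertices. *)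

theory Defs
  imports
    "Graph_Theory.Pair_Digraph"
    "Graph_Theory.Digraph_Isomorphism"
    "Jordan_Normal_Form.Spectral_Radius"
begin

text \<open>
  A finite simple undirected graph is a \<^locale>\<open>pair_graph\<close>: each edge \<open>uv\<close> is represented by
  the two arcs \<open>(u, v)\<close> and \<open>(v, u)\<close>, so \<^const>\<open>out_degree\<close> is the vertex degree and
  \<^const>\<open>digraph_iso\<close> is graph isomorphism.
\<close>

definition dominating_set :: "'a pair_pre_digraph \<Rightarrow> 'a set \<Rightarrow> bool" where
  "dominating_set G S \<longleftrightarrow>
     S \<subseteq> pverts G \<and> (\<forall>v \<in> pverts G - S. \<exists>u \<in> S. (v, u) \<in> parcs G)"

definition domination_number :: "'a pair_pre_digraph \<Rightarrow> nat" where
  "domination_number G = Min (card ` {S. dominating_set G S})"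

text \<open>The matrices are taken with respect to an ordering \<open>vs\<close> of the vertices.\<close>

definition adjacency_mat :: "'a list \<Rightarrow> 'a pair_pre_digraph \<Rightarrow> real mat" where
  "adjacency_mat vs G =
     mat (length vs) (length vs) (\<lambda>(i, j). if (vs ! i, vs ! j) \<in> parcs G then 1 else 0)"

definition degree_mat :: "'a list \<Rightarrow> 'a pair_pre_digraph \<Rightarrow> real mat" where
  "degree_mat vs G =
     mat (length vs) (length vs) (\<lambda>(i, j). if i = j then real (out_degree G (vs ! i)) else 0)"

definition A_alpha :: "real \<Rightarrow> 'a list \<Rightarrow> 'a pair_pre_digraph \<Rightarrow> real mat" where
  "A_alpha \<alpha> vs G = \<alpha> \<cdot>\<^sub>m degree_mat vs G + (1 - \<alpha>) \<cdot>\<^sub>m adjacency_mat vs G"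

definition rho_alpha :: "real \<Rightarrow> 'a list \<Rightarrow> 'a pair_pre_digraph \<Rightarrow> real" where
  "rho_alpha \<alpha> vs G = Max (spectrum (A_alpha \<alpha> vs G))"

definition complete_graph :: "nat \<Rightarrow> nat pair_pre_digraph" where
  "complete_graph s =
     \<lparr> pverts = {..<s}, parcs = {(u, v). u < s \<and> v < s \<and> u \<noteq> v} \<rparr>"

definition graph_copies :: "nat \<Rightarrow> 'a pair_pre_digraph \<Rightarrow> (nat \<times> 'a) pair_pre_digraph" where
  "graph_copies t G =
     \<lparr> pverts = {..<t} \<times> pverts G,
       parcs = {((i, u), (j, v)). i < t \<and> i = j \<and> (u, v) \<in> parcs G} \<rparr>"

definition graph_complement :: "'a pair_pre_digraph \<Rightarrow> 'a pair_pre_digraph" where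
  "graph_complement G =
     \<lparr> pverts = pverts G,
       parcs = {(u, v). u \<in> pverts G \<and> v \<in> pverts G \<and> u \<noteq> v \<and> (u, v) \<notin> parcs G} \<rparr>"

definition disjoint_union ::
    "'a pair_pre_digraph \<Rightarrow> 'b pair_pre_digraph \<Rightarrow> ('a + 'b) pair_pre_digraph" where
  "disjoint_union G H =
     \<lparr> pverts = pverts G <+> pverts H,
       parcs = map_prod Inl Inl ` parcs G \<union> map_prod Inr Inr ` parcs H \<rparr>"

end

theory Submission
  imports Defs
begin

text \<open>
  Write \<open>k = n - \<gamma>\<close>. For every vertex \<open>v\<close> the set \<open>V - N(v)\<close> is dominating, so all degrees are at
  most \<open>k\<close>. These are the row sums of \<open>A\<^sub>\<alpha>\<close>, so comparing at an entry of maximal modulus of an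
  eigenvector gives \<open>\<rho>\<^sub>\<alpha> \<le> k\<close>, and equality forces the eigenvector to be constant on a union \<open>C\<close> of
  components that is \<open>k\<close>-regular. Minimality of the dominating set \<open>V - N(v)\<close>, \<open>v \<in> C\<close>, then shows
  that everything outside \<open>C\<close> is isolated and \<open>C\<close> has at most \<open>k + 2\<close> vertices, so \<open>C\<close> is complete
  or the complement of a perfect matching.
\<close>

section \<open>Real eigenvalues of symmetric matrices\<close>

text \<open>Over the complex numbers an eigenvalue always exists, and symmetry forces it to be real.
  This is needed because \<open>Max\<close> of an empty spectrum would say nothing about
  \<open>rho_alpha\<close>.\<close>

lemma real_symmetric_spectrum_non_empty:
  fixes A :: "real mat"
  assumes A: "A \<in> carrier_mat n n" and sym: "A\<^sup>T = A" and "n > 0"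
  shows "spectrum A \<noteq> {}"
proof -
  define B where "B = map_mat complex_of_real A"
  have B: "B \<in> carrier_mat n n" using A by (simp add: B_def)
  have Bsym: "B\<^sup>T = B"
    using sym by (metis B_def map_mat_transpose)
  obtain c where c: "eigenvalue B c"
    using spectrum_non_empty[OF B \<open>n > 0\<close>] by (auto simp: spectrum_def)
  then obtain v where v: "v \<in> carrier_vec n" "v \<noteq> 0\<^sub>v n" "B *\<^sub>v v = c \<cdot>\<^sub>v v"
    using B by (auto simp: eigenvalue_def eigenvector_def)
  have conj: "B *\<^sub>v conjugate v = cnj c \<cdot>\<^sub>v conjugate v"
  proof -
    have "B *\<^sub>v conjugate v = conjugate (B *\<^sub>v v)"
    proof (rule eq_vecI)
      fix i assume "i < dim_vec (conjugate (B *\<^sub>v v))"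
      then have i: "i < n" using B by simp
      show "(B *\<^sub>v conjugate v) $ i = conjugate (B *\<^sub>v v) $ i"
        using i v(1) A by (simp add: B_def scalar_prod_def)
    qed (use B in simp)
    then show ?thesis using v(3) by (simp add: conjugate_smult_vec)
  qed
  \<comment> \<open>Both sides are evaluated by the eigenvalue equations for \<open>v\<close> and
    its conjugate, with eigenvalues \<open>c\<close> and \<open>cnj c\<close>.\<close>
  have "(B *\<^sub>v v) \<bullet> conjugate v = v \<bullet> (B *\<^sub>v conjugate v)"
    using transpose_vec_mult_scalar[OF B, of "conjugate v" v] v(1) B Bsym
    by (metis carrier_vec_conjugate comm_scalar_prod mult_mat_vec_carrier)
  then have "c * (v \<bullet>c v) = cnj c * (v \<bullet>c v)"
    using v conj by simp
  moreover have "v \<bullet>c v \<noteq> 0" using v conjugate_square_eq_0_vec by blast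
  ultimately have "c = cnj c" by simp
  then obtain r where r: "c = complex_of_real r"
    by (metis Reals_cnj_iff Reals_cases)
  \<comment> \<open>The descent to a real eigenvector goes through the characteristic polynomial:
    its real root \<open>r\<close> is an eigenvalue of \<open>A\<close> itself.\<close>
  have "char_poly B = map_poly complex_of_real (char_poly A)"
    unfolding B_def by (rule of_real_hom.char_poly_hom[OF A])
  then have "poly (char_poly A) r = 0"
    using c r eigenvalue_root_char_poly[OF B] by simp
  then show ?thesis using spectrum_root_char_poly[OF A] by auto
qed

section \<open>Neighbourhoods and the eigenvalue bound\<close>

definition nbhd :: "'a pair_pre_digraph \<Rightarrow> 'a \<Rightarrow> 'a set" where
  "nbhd G v = {u. (v, u) \<in> parcs G}"

lemma out_degree_eq_card_nbhd: "out_degree (with_proj G) v = card (nbhd G v)"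
proof -
  have "out_arcs (with_proj G) v = Pair v ` nbhd G v"
    by (auto simp: out_arcs_def nbhd_def)
  then show ?thesis by (simp add: out_degree_def card_image inj_on_def)
qed

definition regular_closed :: "'a pair_pre_digraph \<Rightarrow> nat \<Rightarrow> 'a set \<Rightarrow> bool" where
  "regular_closed G k C \<longleftrightarrow>
     C \<subseteq> pverts G \<and> C \<noteq> {} \<and> (\<forall>v\<in>C. nbhd G v \<subseteq> C \<and> card (nbhd G v) = k)"

context pair_graph
begin

lemma nbhd_subset: "nbhd G v \<subseteq> pverts G - {v}"
  using arc_snd_in_verts pair_no_loops by (fastforce simp: nbhd_def)

lemma finite_nbhd: "finite (nbhd G v)"
  using nbhd_subset pair_finite_verts by (metis finite_Diff finite_subset)

lemma nbhd_sym: "u \<in> nbhd G v \<longleftrightarrow> v \<in> nbhd G u"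
  using pair_sym_arcs by (auto simp: nbhd_def symmetric_def dest: symD)

lemma A_alpha_mult_vec:
  assumes "distinct vs" "set vs = pverts G" "i < length vs"
  shows "(A_alpha \<alpha> vs G *\<^sub>v vec (length vs) (\<lambda>j. x (vs ! j))) $ i =
    \<alpha> * real (card (nbhd G (vs ! i))) * x (vs ! i) + (1 - \<alpha>) * (\<Sum>u\<in>nbhd G (vs ! i). x u)"
proof -
  let ?v = "vs ! i"
  have "(A_alpha \<alpha> vs G *\<^sub>v vec (length vs) (\<lambda>j. x (vs ! j))) $ i =
    (\<Sum>j<length vs. (\<alpha> * (if i = j then real (card (nbhd G ?v)) else 0) +
       (1 - \<alpha>) * (if vs ! j \<in> nbhd G ?v then 1 else 0)) * x (vs ! j))"
    using assms(3)
    by (auto simp: A_alpha_def degree_mat_def adjacency_mat_def scalar_prod_def nbhd_def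
        out_degree_eq_card_nbhd lessThan_atLeast0 intro!: sum.cong)
  also have "\<dots> = (\<Sum>j<length vs. (if i = j then \<alpha> * real (card (nbhd G ?v)) * x ?v else 0) +
       (1 - \<alpha>) * (if vs ! j \<in> nbhd G ?v then x (vs ! j) else 0))"
    by (intro sum.cong) (auto simp: algebra_simps)
  also have "\<dots> = \<alpha> * real (card (nbhd G ?v)) * x ?v +
       (1 - \<alpha>) * (\<Sum>j<length vs. if vs ! j \<in> nbhd G ?v then x (vs ! j) else 0)"
    using assms(3) by (simp add: sum.distrib sum_distrib_left)
  also have "(\<Sum>j<length vs. if vs ! j \<in> nbhd G ?v then x (vs ! j) else 0) =
      (\<Sum>u\<in>pverts G. if u \<in> nbhd G ?v then x u else 0)"
    using assms by (intro sum.reindex_bij_betw) (auto intro: bij_betw_nth)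
  also have "\<dots> = (\<Sum>u\<in>nbhd G ?v. x u)"
    using nbhd_subset[of ?v] pair_finite_verts
    by (simp add: sum.If_cases) (metis Diff_subset inf.absorb2 order_trans)
  finally show ?thesis .
qed

text \<open>The list \<open>vs\<close> enumerates the vertices bijectively, so vectors are the same
  as functions on vertices. From here on eigenvectors are such functions and the ordering
  disappears.\<close>

lemma spectrum_A_alpha_iff:
  assumes vs: "distinct vs" "set vs = pverts G"
  shows "r \<in> spectrum (A_alpha \<alpha> vs G) \<longleftrightarrow>
    (\<exists>x. (\<exists>v\<in>pverts G. x v \<noteq> 0) \<and> (\<forall>v\<in>pverts G.
       \<alpha> * real (card (nbhd G v)) * x v + (1 - \<alpha>) * (\<Sum>u\<in>nbhd G v. x u) = r * x v))"
    (is "_ \<longleftrightarrow> (\<exists>x. ?ev x)")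
proof -
  let ?n = "length vs" and ?A = "A_alpha \<alpha> vs G"
  let ?w = "\<lambda>x. vec ?n (\<lambda>j. x (vs ! j))"
  have dim: "dim_row ?A = ?n" by (simp add: A_alpha_def adjacency_mat_def)
  have key: "eigenvector ?A (?w x) r \<longleftrightarrow> ?ev x" for x
  proof -
    have "?w x \<noteq> 0\<^sub>v ?n \<longleftrightarrow> (\<exists>v\<in>pverts G. x v \<noteq> 0)"
      unfolding vs(2)[symmetric] by (auto simp: vec_eq_iff in_set_conv_nth Bex_def)
    moreover have "?A *\<^sub>v ?w x = r \<cdot>\<^sub>v ?w x \<longleftrightarrow> (\<forall>v\<in>pverts G.
       \<alpha> * real (card (nbhd G v)) * x v + (1 - \<alpha>) * (\<Sum>u\<in>nbhd G v. x u) = r * x v)"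
      using A_alpha_mult_vec[OF vs, of _ \<alpha> x] dim
      by (simp add: vec_eq_iff vs(2)[symmetric] all_set_conv_all_nth del: index_mult_mat_vec)
    ultimately show ?thesis by (simp add: eigenvector_def dim)
  qed
  have "\<exists>x. w = ?w x" if "w \<in> carrier_vec ?n" for w :: "real vec"
  proof -
    \<comment> \<open>The entry of \<open>w\<close> at the unique position of \<open>v\<close> in
      \<open>vs\<close>.\<close>
    define x where "x v = w $ (the_inv_into {..<?n} ((!) vs) v)" for v
    have "w = ?w x"
      unfolding x_def using that vs by (auto simp: the_inv_into_f_f inj_on_nth intro!: eq_vecI)
    then show ?thesis by (rule exI[where x = x])
  qed
  then have "eigenvalue ?A r \<longleftrightarrow> (\<exists>x. eigenvector ?A (?w x) r)"
    unfolding eigenvalue_def by (metis dim eigenvector_def)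
  then show ?thesis by (simp only: spectrum_def mem_Collect_eq key)
qed

text \<open>A maximum principle: where an eigenvector is largest, the eigenvalue is at most the
  degree, and equality propagates the maximum to all neighbours.\<close>

lemma spectrum_A_alpha_le_degree:
  assumes vs: "distinct vs" "set vs = pverts G"
    and "\<alpha> < 1" and deg: "\<And>v. v \<in> pverts G \<Longrightarrow> card (nbhd G v) \<le> k"
    and r: "r \<in> spectrum (A_alpha \<alpha> vs G)"
  shows "r \<le> real k" and "r = real k \<Longrightarrow> \<exists>C. regular_closed G k C"
proof -
  obtain x0 where x0: "\<exists>v\<in>pverts G. x0 v \<noteq> 0"
    "\<And>v. v \<in> pverts G \<Longrightarrow>
       \<alpha> * real (card (nbhd G v)) * x0 v + (1 - \<alpha>) * (\<Sum>u\<in>nbhd G v. x0 u) = r * x0 v"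
    using r spectrum_A_alpha_iff[OF vs] by blast
  obtain m where m: "m \<in> pverts G" "\<And>v. v \<in> pverts G \<Longrightarrow> \<bar>x0 v\<bar> \<le> \<bar>x0 m\<bar>"
  proof -
    have "Max ((\<lambda>v. \<bar>x0 v\<bar>) ` pverts G) \<in> (\<lambda>v. \<bar>x0 v\<bar>) ` pverts G"
      using x0(1) pair_finite_verts by (intro Max_in) auto
    then obtain m where "m \<in> pverts G" "\<bar>x0 m\<bar> = Max ((\<lambda>v. \<bar>x0 v\<bar>) ` pverts G)" by auto
    then show ?thesis using that pair_finite_verts by simp
  qed
  define M where "M = \<bar>x0 m\<bar>"
  \<comment> \<open>Multiplying by the sign makes the entry of largest modulus positive, so that it
    bounds all entries without absolute values.\<close>
  define x where "x v = sgn (x0 m) * x0 v" for v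
  have M: "M > 0" unfolding M_def using x0(1) m(2) by fastforce
  have xm: "x m = M" by (simp add: x_def M_def abs_sgn mult.commute)
  have xle: "x v \<le> M" if "v \<in> pverts G" for v
    using m(2)[OF that] by (auto simp: x_def M_def sgn_if)
  have ev: "\<alpha> * real (card (nbhd G v)) * x v + (1 - \<alpha>) * (\<Sum>u\<in>nbhd G v. x u) = r * x v"
    if "v \<in> pverts G" for v
    using arg_cong[OF x0(2)[OF that], of "\<lambda>t. sgn (x0 m) * t"]
    unfolding x_def sum_distrib_left[symmetric] by (simp add: algebra_simps)
  have sum_le: "(\<Sum>u\<in>nbhd G v. x u) \<le> real (card (nbhd G v)) * M" for v
    using nbhd_subset[of v] xle by (intro sum_bounded_above) auto
  \<comment> \<open>The eigenvalue equation at a maximum, rearranged so that the left side is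
    nonnegative; it yields the bound now and the equality case later.\<close>
  have gap: "(1 - \<alpha>) * (real (card (nbhd G v)) * M - (\<Sum>u\<in>nbhd G v. x u)) =
      (real (card (nbhd G v)) - r) * M" if "v \<in> pverts G" "x v = M" for v
    using ev[OF that(1)] that(2) by (simp add: algebra_simps)
  have r_le: "r \<le> real (card (nbhd G v))" if "v \<in> pverts G" "x v = M" for v
  proof -
    have "0 \<le> (real (card (nbhd G v)) - r) * M"
      using gap[OF that] sum_le[of v] \<open>\<alpha> < 1\<close> by (metis diff_ge_0_iff_ge less_imp_le mult_nonneg_nonneg)
    then show ?thesis using M by (simp add: zero_le_mult_iff)
  qed
  show "r \<le> real k" using r_le[OF m(1) xm] deg[OF m(1)] by linarith
  assume rk: "r = real k"
  define C where "C = {v \<in> pverts G. x v = M}"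
  have "regular_closed G k C"
    unfolding regular_closed_def
  proof (intro conjI ballI)
    show "C \<subseteq> pverts G" by (auto simp: C_def)
    show "C \<noteq> {}" using m(1) xm by (auto simp: C_def)
    fix v assume "v \<in> C"
    then have v: "v \<in> pverts G" "x v = M" by (auto simp: C_def)
    show card: "card (nbhd G v) = k" using r_le[OF v] deg[OF v(1)] rk by simp
    \<comment> \<open>With degree and eigenvalue both \<open>k\<close> the right side of
      \<open>gap\<close> vanishes, and \<open>1 - \<alpha>\<close> is positive. The summands are
      nonnegative, so each is zero.\<close>
    have "(\<Sum>u\<in>nbhd G v. M - x u) = 0"
      using gap[OF v] card rk \<open>\<alpha> < 1\<close> by (simp add: sum_subtractf)
    then have "\<forall>u\<in>nbhd G v. M - x u = 0"
      using nbhd_subset[of v] xle finite_nbhd[of v] by (subst (asm) sum_nonneg_eq_0_iff) auto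
    then show "nbhd G v \<subseteq> C" using nbhd_subset[of v] by (auto simp: C_def)
  qed
  then show "\<exists>C. regular_closed G k C" by blast
qed

text \<open>The indicator function of \<open>C\<close> is an eigenvector: inside \<open>C\<close>
  all \<open>k\<close> neighbours count, and a vertex outside has no neighbour in \<open>C\<close>
  because adjacency is symmetric.\<close>

lemma regular_closed_degree_in_spectrum:
  assumes vs: "distinct vs" "set vs = pverts G" and C: "regular_closed G k C"
  shows "real k \<in> spectrum (A_alpha \<alpha> vs G)"
proof -
  let ?x = "\<lambda>v. of_bool (v \<in> C) :: real"
  have "\<alpha> * real (card (nbhd G v)) * ?x v + (1 - \<alpha>) * (\<Sum>u\<in>nbhd G v. ?x u) = real k * ?x v"
    if "v \<in> pverts G" for v
  proof (cases "v \<in> C")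
    case True
    then have "nbhd G v \<subseteq> C" using C by (simp add: regular_closed_def)
    then have "(\<Sum>u\<in>nbhd G v. ?x u) = (\<Sum>u\<in>nbhd G v. 1)"
      by (intro sum.cong) auto
    then show ?thesis using True C by (simp add: regular_closed_def algebra_simps)
  next
    case False
    then have "nbhd G v \<inter> C = {}" using C nbhd_sym by (force simp: regular_closed_def)
    then have "(\<Sum>u\<in>nbhd G v. ?x u) = 0" by (intro sum.neutral) auto
    then show ?thesis using False by simp
  qed
  moreover have "\<exists>v\<in>pverts G. ?x v \<noteq> 0"
    using C by (auto simp: regular_closed_def)
  ultimately show ?thesis
    unfolding spectrum_A_alpha_iff[OF vs] by (intro exI[of _ ?x] conjI ballI)
qed

text \<open>The spectrum is finite and nonempty, so \<open>rho_alpha\<close> is itself an eigenvalue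
  and the maximum principle applies to it; the indicator eigenvector gives the converse.\<close>

lemma rho_alpha_le_degree:
  assumes vs: "distinct vs" "set vs = pverts G" and ne: "pverts G \<noteq> {}"
    and \<alpha>: "\<alpha> < 1" and deg: "\<And>v. v \<in> pverts G \<Longrightarrow> card (nbhd G v) \<le> k"
  shows "rho_alpha \<alpha> vs G \<le> real k"
    and "rho_alpha \<alpha> vs G = real k \<longleftrightarrow> (\<exists>C. regular_closed G k C)"
proof -
  let ?A = "A_alpha \<alpha> vs G"
  have A: "?A \<in> carrier_mat (length vs) (length vs)"
    by (simp add: A_alpha_def adjacency_mat_def degree_mat_def)
  have "?A\<^sup>T = ?A"
    using nbhd_sym by (intro eq_matI)
      (auto simp: A_alpha_def adjacency_mat_def degree_mat_def nbhd_def)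
  then have nonempty: "spectrum ?A \<noteq> {}"
    using real_symmetric_spectrum_non_empty[OF A] ne vs(2) by fastforce
  have fin: "finite (spectrum ?A)" by (rule card_finite_spectrum[OF A])
  have mem: "rho_alpha \<alpha> vs G \<in> spectrum ?A"
    unfolding rho_alpha_def by (rule Max_in[OF fin nonempty])
  note bound = spectrum_A_alpha_le_degree[OF vs \<alpha> deg]
  show le: "rho_alpha \<alpha> vs G \<le> real k" using bound(1)[OF _ mem] by blast
  show "rho_alpha \<alpha> vs G = real k \<longleftrightarrow> (\<exists>C. regular_closed G k C)"
  proof
    assume "rho_alpha \<alpha> vs G = real k"
    then show "\<exists>C. regular_closed G k C" using bound(2)[OF _ mem] by blast
  next
    assume "\<exists>C. regular_closed G k C"
    then have "real k \<in> spectrum ?A" using regular_closed_degree_in_spectrum[OF vs] by blast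
    then have "real k \<le> rho_alpha \<alpha> vs G" unfolding rho_alpha_def using fin by simp
    with le show "rho_alpha \<alpha> vs G = real k" by simp
  qed
qed

section \<open>Domination and the structure of the equality case\<close>

lemma domination_number_le:
  assumes "dominating_set G S"
  shows "domination_number G \<le> card S"
proof -
  have "{S. dominating_set G S} \<subseteq> Pow (pverts G)" by (auto simp: dominating_set_def)
  then have "finite {S. dominating_set G S}"
    using pair_finite_verts by (meson finite_Pow_iff finite_subset)
  then show ?thesis using assms by (simp add: domination_number_def)
qed

lemma dominating_set_iff_nbhd:
  "dominating_set G S \<longleftrightarrow> S \<subseteq> pverts G \<and> (\<forall>v\<in>pverts G - S. \<exists>u\<in>S. v \<in> nbhd G u)"
  using nbhd_sym by (auto simp: dominating_set_def nbhd_def)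

lemma degree_add_domination_number_le:
  assumes "v \<in> pverts G"
  shows "card (nbhd G v) + domination_number G \<le> card (pverts G)"
proof -
  \<comment> \<open>The vertex \<open>v\<close> itself stays in the set and dominates everything
    that was removed.\<close>
  have "dominating_set G (pverts G - nbhd G v)"
    using assms nbhd_subset[of v] by (auto simp: dominating_set_iff_nbhd)
  then have "domination_number G \<le> card (pverts G - nbhd G v)" by (rule domination_number_le)
  moreover have "card (pverts G - nbhd G v) = card (pverts G) - card (nbhd G v)"
    using nbhd_subset[of v] finite_nbhd by (intro card_Diff_subset) auto
  moreover have "card (nbhd G v) \<le> card (pverts G)"
    using nbhd_subset[of v] pair_finite_verts by (intro card_mono) auto
  ultimately show ?thesis by simp
qed

text \<open>
  Since \<open>V - N(v)\<close> is a minimum dominating set, \<open>W = V - N[v]\<close> is independent; two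
  vertices of \<open>W \<inter> C\<close> would have the same neighbours as \<open>v\<close> and could be traded for one of these.
\<close>

lemma regular_closed_structure:
  assumes C: "regular_closed G k C" and k: "k > 0"
    and card: "card (pverts G) = k + domination_number G"
  shows "\<forall>v\<in>pverts G - C. nbhd G v = {}" and "card C = k + 1 \<or> card C = k + 2"
proof -
  obtain v where v: "v \<in> C" using C by (auto simp: regular_closed_def)
  define N where "N = nbhd G v"
  define W where "W = pverts G - insert v N"
  have CV: "C \<subseteq> pverts G" and NC: "N \<subseteq> C" and cN: "card N = k"
    using C v by (auto simp: regular_closed_def N_def)
  have fin: "finite N" "finite W"
    unfolding N_def W_def using finite_nbhd pair_finite_verts by auto
  have vN: "v \<notin> N" using nbhd_subset[of v] by (auto simp: N_def)
  have V: "pverts G = insert v (N \<union> W)" using CV NC v by (auto simp: W_def)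
  have vW: "v \<notin> W" "N \<inter> W = {}" by (auto simp: W_def)
  \<comment> \<open>Thus \<open>insert v W\<close>, which is \<open>pverts G - N\<close>, has
    minimum size, and any dominating set with at most \<open>card W\<close> vertices is a
    contradiction.\<close>
  have cW: "card W + 1 = domination_number G"
    using card V fin cN vN vW by (simp add: card_Un_disjoint)
  have indep: "nbhd G w \<subseteq> N" if w: "w \<in> W" for w
  proof
    fix u assume u: "u \<in> nbhd G w"
    show "u \<in> N"
    proof (rule ccontr)
      assume "u \<notin> N"
      moreover have "u \<noteq> v" using u w nbhd_sym[of v w] by (auto simp: W_def N_def)
      ultimately have uW: "u \<in> W" "u \<noteq> w" using u nbhd_subset[of w] by (auto simp: W_def)
      \<comment> \<open>An edge inside \<open>W\<close> makes one end redundant: \<open>u\<close>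
        dominates \<open>w\<close>, while \<open>v\<close> still dominates \<open>N\<close>.\<close>
      have "dominating_set G (insert v (W - {w}))"
        unfolding dominating_set_iff_nbhd using V uW u nbhd_sym[of u w] by (auto simp: N_def)
      then have "domination_number G \<le> card (insert v (W - {w}))" by (rule domination_number_le)
      also have "\<dots> = card W" using card.remove[OF fin(2) w] fin vW by simp
      finally show False using cW by simp
    qed
  qed
  show "\<forall>w\<in>pverts G - C. nbhd G w = {}"
  proof
    fix w assume w: "w \<in> pverts G - C"
    then have "w \<in> W" using NC v by (auto simp: W_def)
    then have sub: "nbhd G w \<subseteq> C" using indep NC by blast
    \<comment> \<open>A neighbour \<open>u\<close> lies in \<open>C\<close>, and \<open>C\<close> is
      closed under adjacency, so it would contain \<open>w\<close> as well.\<close>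
    have "w \<in> C" if "u \<in> nbhd G w" for u
      using that sub C nbhd_sym[of u w] by (auto simp: regular_closed_def)
    then show "nbhd G w = {}" using w by auto
  qed
  \<comment> \<open>The inclusion from \<open>indep\<close> is an equality because both sets have
    \<open>k\<close> elements.\<close>
  have same: "nbhd G w = N" if "w \<in> W \<inter> C" for w
    using indep[of w] that C fin cN by (intro card_subset_eq) (auto simp: regular_closed_def)
  have "card (W \<inter> C) \<le> 1"
  proof (rule ccontr)
    assume "\<not> card (W \<inter> C) \<le> 1"
    then have "\<exists>w w'. w \<in> W \<inter> C \<and> w' \<in> W \<inter> C \<and> w \<noteq> w'"
      using fin by (metis One_nat_def card_le_Suc0_iff_eq finite_Int)
    then obtain w w' where w: "w \<in> W \<inter> C" "w' \<in> W \<inter> C" "w \<noteq> w'" by blast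
    obtain u where u: "u \<in> N" using k cN by fastforce
    have uw: "w \<in> nbhd G u" "w' \<in> nbhd G u" using same[OF w(1)] same[OF w(2)] u nbhd_sym[of u] by auto
    \<comment> \<open>One vertex \<open>u\<close> of \<open>N\<close>, which exists since
      \<open>k > 0\<close>, dominates both removed vertices; the size drops by two and rises by one
      compared with \<open>insert v W\<close>.\<close>
    let ?S = "insert u (insert v (W - {w, w'}))"
    have "dominating_set G ?S"
      unfolding dominating_set_iff_nbhd using V u uw by (auto simp: N_def)
    then have "domination_number G \<le> card ?S" by (rule domination_number_le)
    also have "\<dots> = 2 + card (W - {w, w'})"
      using u vN vW fin by (subst card_insert_disjoint; auto)
    also have "\<dots> = card W"
      using w fin card_mono[of W "{w, w'}"] by (simp add: card_Diff_subset)
    finally show False using cW by simp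
  qed
  moreover have "card (insert v (N \<union> (W \<inter> C))) = 1 + k + card (W \<inter> C)"
  proof -
    have "card (N \<union> (W \<inter> C)) = k + card (W \<inter> C)"
      using fin vW cN by (subst card_Un_disjoint) auto
    then show ?thesis using fin vN vW by simp
  qed
  moreover have "insert v (N \<union> (W \<inter> C)) = C" using V NC v CV by auto
  ultimately have "card (W \<inter> C) \<le> 1" "card C = 1 + k + card (W \<inter> C)" by simp_all
  then show "card C = k + 1 \<or> card C = k + 2" by linarith
qed

end

section \<open>Isomorphisms with disjoint unions\<close>

text \<open>A general digraph isomorphism carries separate maps for vertices, arcs, tails and heads.
  Here tails and heads are the projections, so the vertex map determines the action on arcs.\<close>

lemma digraph_iso_with_proj_iff:
  assumes "pair_wf_digraph G"
  shows "digraph_iso (with_proj G) (with_proj H) \<longleftrightarrow>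
    (\<exists>f. inj_on f (pverts G) \<and> pverts H = f ` pverts G \<and> parcs H = map_prod f f ` parcs G)"
proof
  assume "digraph_iso (with_proj G) (with_proj H)"
  then obtain h where h: "pre_digraph.digraph_isomorphism (with_proj G) h"
    "with_proj H = app_iso h (with_proj G)"
    by (auto simp: digraph_iso_def)
  have eqs: "pverts H = iso_verts h ` pverts G" "parcs H = iso_arcs h ` parcs G"
    "iso_tail h = fst" "iso_head h = snd"
    using arg_cong[OF h(2), of verts] arg_cong[OF h(2), of arcs]
      arg_cong[OF h(2), of tail] arg_cong[OF h(2), of head] by simp_all
  have "iso_arcs h a = map_prod (iso_verts h) (iso_verts h) a" if "a \<in> parcs G" for a
    using h(1) that eqs(3,4)
    by (cases a) (auto simp: pre_digraph.digraph_isomorphism_def prod_eq_iff)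
  then have "iso_arcs h ` parcs G = map_prod (iso_verts h) (iso_verts h) ` parcs G"
    by (intro image_cong) auto
  then show "\<exists>f. inj_on f (pverts G) \<and> pverts H = f ` pverts G \<and> parcs H = map_prod f f ` parcs G"
    using eqs h(1) by (auto simp: pre_digraph.digraph_isomorphism_def)
next
  interpret pair_wf_digraph G by fact
  assume "\<exists>f. inj_on f (pverts G) \<and> pverts H = f ` pverts G \<and> parcs H = map_prod f f ` parcs G"
  then obtain f where f: "inj_on f (pverts G)" "pverts H = f ` pverts G"
    "parcs H = map_prod f f ` parcs G" by blast
  let ?h = "\<lparr>iso_verts = f, iso_arcs = map_prod f f, iso_head = snd, iso_tail = fst\<rparr>"
  have "inj_on (map_prod f f) (parcs G)"
    using map_prod_inj_on[OF f(1) f(1)]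
    by (rule inj_on_subset) (use arc_fst_in_verts arc_snd_in_verts in force)
  then have "pre_digraph.digraph_isomorphism (with_proj G) ?h"
    using f(1) assms by (auto simp: pre_digraph.digraph_isomorphism_def wf_digraph_wp_iff)
  moreover have "with_proj H = app_iso ?h (with_proj G)"
    using f by (simp add: app_iso_def with_proj_def)
  ultimately show "digraph_iso (with_proj G) (with_proj H)"
    unfolding digraph_iso_def by blast
qed

text \<open>No arc joins the two summands, so the preimage of the first one is closed under
  adjacency and inherits its regularity. This serves both extremal graphs, whose first summand is
  regular.\<close>

lemma disjoint_union_iso_regular_closed:
  assumes G: "pair_wf_digraph G"
    and iso: "digraph_iso (with_proj G) (with_proj (disjoint_union H J))"
    and H: "regular_closed H k (pverts H)"
  shows "\<exists>C. regular_closed G k C"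
proof -
  interpret pair_wf_digraph G by fact
  obtain f where f: "inj_on f (pverts G)" "pverts (disjoint_union H J) = f ` pverts G"
    "parcs (disjoint_union H J) = map_prod f f ` parcs G"
    using iso[unfolded digraph_iso_with_proj_iff[OF G]] by (elim exE conjE) (rule that)
  define C where "C = {v \<in> pverts G. f v \<in> Inl ` pverts H}"
  have Inl_image: "Inl ` pverts H \<subseteq> f ` pverts G"
    using f(2) by (auto simp: disjoint_union_def)
  have arc_iff: "(v, u) \<in> parcs G \<longleftrightarrow> (f v, f u) \<in> parcs (disjoint_union H J)"
    if "v \<in> pverts G" "u \<in> pverts G" for u v
  proof -
    have "inj_on (map_prod f f) (pverts G \<times> pverts G)" by (rule map_prod_inj_on[OF f(1) f(1)])
    moreover have "parcs G \<subseteq> pverts G \<times> pverts G" using arc_fst_in_verts arc_snd_in_verts by force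
    ultimately show ?thesis
      using that unfolding f(3)
      by (metis (no_types, lifting) SigmaI inj_on_image_mem_iff map_prod_simp)
  qed
  have nb: "f ` nbhd G v = Inl ` nbhd H h" if "v \<in> pverts G" "f v = Inl h" for v h
  proof -
    \<comment> \<open>Well-formedness of \<open>H\<close> is not among the assumptions; closedness
      supplies what is required for every neighbour of \<open>h\<close> to have a preimage under
      \<open>f\<close>.\<close>
    have "nbhd H h \<subseteq> pverts H" if "h \<in> pverts H" using H that by (auto simp: regular_closed_def)
    moreover have "Inl h \<in> pverts (disjoint_union H J)" using f(2) that by (metis imageI)
    then have "h \<in> pverts H" by (auto simp: disjoint_union_def)
    ultimately have sub: "Inl ` nbhd H h \<subseteq> f ` pverts G" using Inl_image by blast
    have mem: "f u \<in> Inl ` nbhd H h \<longleftrightarrow> u \<in> nbhd G v" if "u \<in> pverts G" for u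
      using arc_iff[OF \<open>v \<in> pverts G\<close> that] \<open>f v = Inl h\<close>
      by (auto simp: disjoint_union_def nbhd_def)
    have subG: "nbhd G v \<subseteq> pverts G" using arc_snd_in_verts by (force simp: nbhd_def)
    show ?thesis
    proof (intro equalityI image_subsetI)
      fix u assume "u \<in> nbhd G v"
      then show "f u \<in> Inl ` nbhd H h" using mem[of u] subG by auto
    next
      fix w assume w: "w \<in> nbhd H h"
      then obtain u where u: "u \<in> pverts G" "Inl w = f u" using sub by blast
      then have "u \<in> nbhd G v" using mem[of u] w by (metis imageI)
      then show "Inl w \<in> f ` nbhd G v" unfolding u(2) by (rule imageI)
    qed
  qed
  have "regular_closed G k C"
    unfolding regular_closed_def
  proof (intro conjI ballI)
    show "C \<subseteq> pverts G" by (auto simp: C_def)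
    obtain h where "h \<in> pverts H" using H by (auto simp: regular_closed_def)
    then obtain v where "v \<in> pverts G" "f v = Inl h" using Inl_image by (metis image_iff subset_iff)
    then show "C \<noteq> {}" using \<open>h \<in> pverts H\<close> by (auto simp: C_def)
    fix v assume "v \<in> C"
    then obtain h where h: "h \<in> pverts H" "v \<in> pverts G" "f v = Inl h" by (auto simp: C_def)
    have sub: "nbhd G v \<subseteq> pverts G" using arc_snd_in_verts by (force simp: nbhd_def)
    have "Inl ` nbhd H h \<subseteq> Inl ` pverts H" using H h(1) by (auto simp: regular_closed_def)
    then have "f ` nbhd G v \<subseteq> Inl ` pverts H" using nb[OF h(2,3)] by simp
    then show "nbhd G v \<subseteq> C" using sub unfolding C_def by blast
    have "card (nbhd G v) = card (f ` nbhd G v)"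
      using inj_on_subset[OF f(1) sub] by (simp add: card_image)
    also have "\<dots> = card (nbhd H h)" unfolding nb[OF h(2,3)] by (simp add: card_image)
    also have "\<dots> = k" using H h(1) by (auto simp: regular_closed_def)
    finally show "card (nbhd G v) = k" .
  qed
  then show ?thesis by blast
qed

text \<open>The vertices outside \<open>C\<close> meet no arc, so \<open>g\<close> extends by an
  arbitrary bijection onto the isolated vertices.\<close>

lemma digraph_iso_disjoint_union_isolated:
  assumes G: "pair_wf_digraph G" and fin: "finite (pverts G)" and C: "C \<subseteq> pverts G"
    and arcs: "parcs G \<subseteq> C \<times> C"
    and g: "bij_betw g C (pverts H)" and H: "parcs H = map_prod g g ` parcs G"
    and m: "card (pverts G) = card C + m"
  shows "digraph_iso (with_proj G)
    (with_proj (disjoint_union H (graph_copies m (complete_graph 1))))"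
proof -
  have "card (pverts G - C) = m"
    using C fin m by (simp add: card_Diff_subset finite_subset)
  \<comment> \<open>This product is the vertex set of
    \<open>graph_copies m (complete_graph 1)\<close>.\<close>
  moreover have "card ({..<m} \<times> {0::nat}) = m" by simp
  ultimately obtain e where e: "bij_betw e (pverts G - C) ({..<m} \<times> {0::nat})"
    using fin by (metis bij_betw_iff_card finite_Diff finite_SigmaI finite_lessThan finite.intros)
  define f where "f v = (if v \<in> C then Inl (g v) else Inr (e v))" for v
  have "inj_on f (pverts G)"
    using g e by (auto simp: inj_on_def f_def bij_betw_def)
  moreover have "f ` pverts G = Inl ` g ` C \<union> Inr ` e ` (pverts G - C)"
    using C by (auto simp: f_def)
  then have "pverts (disjoint_union H (graph_copies m (complete_graph 1))) = f ` pverts G"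
    using g e by (auto simp: bij_betw_def disjoint_union_def graph_copies_def complete_graph_def Plus_def)
  moreover have "map_prod f f ` parcs G = map_prod Inl Inl ` map_prod g g ` parcs G"
    unfolding image_image using arcs by (intro image_cong) (auto simp: f_def)
  then have "parcs (disjoint_union H (graph_copies m (complete_graph 1))) = map_prod f f ` parcs G"
    by (auto simp: H disjoint_union_def graph_copies_def complete_graph_def)
  ultimately show ?thesis
    unfolding digraph_iso_with_proj_iff[OF G] by (intro exI[of _ f] conjI)
qed

section \<open>Recognising cliques and cocktail party graphs\<close>

text \<open>The orbits of \<open>p\<close> are pairs. Numbering them gives the first coordinate, and
  the second tells the two members apart, which matches the vertices of
  \<open>graph_copies t (complete_graph 2)\<close>.\<close>

lemma fixpoint_free_involution_coordinates:
  assumes fin: "finite C" and inv: "\<And>u. u \<in> C \<Longrightarrow> p u \<in> C \<and> p u \<noteq> u \<and> p (p u) = u"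
  shows "even (card C)"
    and "\<exists>g. bij_betw g C ({..<card C div 2} \<times> {..<2::nat}) \<and>
      (\<forall>u\<in>C. \<forall>v\<in>C. fst (g u) = fst (g v) \<longleftrightarrow> v = u \<or> v = p u)"
proof -
  define P where "P u = {u, p u}" for u
  have P_eq: "P u = P v \<longleftrightarrow> v = u \<or> v = p u" if "u \<in> C" "v \<in> C" for u v
    using inv[OF that(1)] inv[OF that(2)] by (auto simp: P_def doubleton_eq_iff)
  define t where "t = card (P ` C)"
  obtain e where e: "bij_betw e (P ` C) {..<t}"
    using fin by (metis t_def bij_betw_iff_card card_lessThan finite_imageI finite_lessThan)
  \<comment> \<open>The choice depends only on the orbit as a set, so \<open>u\<close> and
    \<open>p u\<close> agree on it and exactly one of them gets 0.\<close>
  define s where "s u = (if u = (SOME z. z \<in> P u) then 0 else 1::nat)" for u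
  define g where "g u = (e (P u), s u)" for u
  have rep: "(SOME z. z \<in> P u) = u \<or> (SOME z. z \<in> P u) = p u" for u
    using someI[of "\<lambda>z. z \<in> P u" u] by (auto simp: P_def)
  have s_flip: "s (p u) = 1 - s u" if "u \<in> C" for u
  proof -
    have "P (p u) = P u" using inv[OF that] by (auto simp: P_def)
    then show ?thesis using rep[of u] inv[OF that] by (auto simp: s_def)
  qed
  have fst: "fst (g u) = fst (g v) \<longleftrightarrow> v = u \<or> v = p u" if "u \<in> C" "v \<in> C" for u v
    using e that P_eq[OF that] by (auto simp: g_def bij_betw_def inj_on_def)
  have s01: "s u = 0 \<or> s u = 1" for u by (simp add: s_def)
  have inj: "inj_on g C"
  proof (rule inj_onI)
    fix u v assume uv: "u \<in> C" "v \<in> C" "g u = g v"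
    then have "v = u \<or> v = p u" using fst[OF uv(1,2)] by simp
    then show "u = v" using uv s_flip[OF uv(1)] s01[of u] by (auto simp: g_def)
  qed
  have "g ` C = {..<t} \<times> {..<2}"
  proof
    show "g ` C \<subseteq> {..<t} \<times> {..<2}" using e by (auto simp: g_def s_def bij_betw_def)
    show "{..<t} \<times> {..<2} \<subseteq> g ` C"
    proof
      fix a assume "a \<in> {..<t} \<times> {..<2::nat}"
      then obtain i b where a: "a = (i, b)" "i < t" "b < 2" by auto
      then have "i \<in> e ` P ` C" using e by (simp add: bij_betw_def)
      then obtain u where u: "u \<in> C" "e (P u) = i" by blast
      have "P (p u) = P u" using inv[OF u(1)] by (auto simp: P_def)
      then have "a = g u \<or> a = g (p u)"
        using a u s_flip[OF u(1)] s01[of u] by (auto simp: g_def)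
      then show "a \<in> g ` C" using u(1) inv by auto
    qed
  qed
  with inj have bij: "bij_betw g C ({..<t} \<times> {..<2})" by (simp add: bij_betw_def)
  then have "card C = t * 2" by (simp add: bij_betw_same_card card_cartesian_product)
  then show "even (card C)"
    and "\<exists>g. bij_betw g C ({..<card C div 2} \<times> {..<2::nat}) \<and>
      (\<forall>u\<in>C. \<forall>v\<in>C. fst (g u) = fst (g v) \<longleftrightarrow> v = u \<or> v = p u)"
    using bij fst by auto
qed

lemma pverts_complete_graph: "pverts (complete_graph s) = {..<s}"
  by (simp add: complete_graph_def)

lemma nbhd_complete_graph: "v < s \<Longrightarrow> nbhd (complete_graph s) v = {..<s} - {v}"
  by (auto simp: nbhd_def complete_graph_def)

text \<open>The two vertices of one copy are joined before complementing, so afterwards exactly the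
  vertices of different copies are adjacent.\<close>

lemma nbhd_cocktail_party:
  assumes "i < t" "b < 2"
  shows "nbhd (graph_complement (graph_copies t (complete_graph 2))) (i, b) =
    {..<t} \<times> {..<2} - {i} \<times> {..<2}"
  using assms by (auto simp: nbhd_def graph_complement_def graph_copies_def complete_graph_def)

context pair_graph
begin

text \<open>A vertex of \<open>C\<close> has \<open>k\<close> neighbours among the \<open>k\<close>
  other vertices of \<open>C\<close>, so \<open>C\<close> is a clique.\<close>

lemma regular_closed_complete_iso:
  assumes C: "regular_closed G k C" and isolated: "\<forall>v\<in>pverts G - C. nbhd G v = {}"
    and cC: "card C = k + 1" and m: "card (pverts G) = card C + m"
  shows "digraph_iso (with_proj G)
    (with_proj (disjoint_union (complete_graph (k + 1)) (graph_copies m (complete_graph 1))))"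
proof -
  have CV: "C \<subseteq> pverts G" using C by (simp add: regular_closed_def)
  then have finC: "finite C" using pair_finite_verts finite_subset by blast
  have nb: "nbhd G v = C - {v}" if "v \<in> C" for v
    using that C nbhd_subset[of v] finC cC
    by (intro card_subset_eq) (auto simp: regular_closed_def)
  have arcs: "parcs G = {(u, v). u \<in> C \<and> v \<in> C \<and> u \<noteq> v}"
  proof (rule Set.set_eqI)
    fix a :: "'a \<times> 'a"
    obtain u v where a: "a = (u, v)" by (cases a)
    show "a \<in> parcs G \<longleftrightarrow> a \<in> {(u, v). u \<in> C \<and> v \<in> C \<and> u \<noteq> v}"
      unfolding a using nb[of u] isolated arc_fst_in_verts[of "(u, v)"]
      by (cases "u \<in> C") (auto simp: nbhd_def)
  qed
  obtain g where g: "bij_betw g C {..<k + 1}"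
    using finC cC by (metis bij_betw_iff_card card_lessThan finite_lessThan)
  show ?thesis
  proof (rule digraph_iso_disjoint_union_isolated[OF _ pair_finite_verts CV _ _ _ m])
    show "pair_wf_digraph G" by unfold_locales
    show "parcs G \<subseteq> C \<times> C" using arcs by auto
    show "bij_betw g C (pverts (complete_graph (k + 1)))" using g by (simp add: complete_graph_def)
    show "parcs (complete_graph (k + 1)) = map_prod g g ` parcs G"
    proof -
      have inj: "inj_on g C" and "g ` C = {..<k + 1}" using g by (auto simp: bij_betw_def)
      then have "parcs (complete_graph (k + 1)) = {(a, b). a \<in> g ` C \<and> b \<in> g ` C \<and> a \<noteq> b}"
        by (simp add: complete_graph_def)
      also have "\<dots> = map_prod g g ` parcs G"
        unfolding arcs using inj by (auto simp: image_iff dest: inj_onD)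
      finally show ?thesis .
    qed
  qed
qed

text \<open>Each vertex \<open>v\<close> of \<open>C\<close> misses exactly one other vertex
  \<open>p v\<close> of \<open>C\<close>. Non-adjacency is symmetric, so \<open>p\<close> is a
  fixpoint-free involution whose orbits are the removed matching.\<close>

lemma regular_closed_cocktail_party_iso:
  assumes C: "regular_closed G k C" and isolated: "\<forall>v\<in>pverts G - C. nbhd G v = {}"
    and cC: "card C = k + 2" and m: "card (pverts G) = card C + m"
  shows "even k" and "digraph_iso (with_proj G)
    (with_proj (disjoint_union (graph_complement (graph_copies ((k + 2) div 2) (complete_graph 2)))
      (graph_copies m (complete_graph 1))))"
proof -
  have CV: "C \<subseteq> pverts G" using C by (simp add: regular_closed_def)
  then have finC: "finite C" using pair_finite_verts finite_subset by blast
  have "\<exists>w. C - {v} - nbhd G v = {w}" if "v \<in> C" for v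
  proof -
    have "card (C - {v} - nbhd G v) = 1"
      using that C nbhd_subset[of v] finC finite_nbhd cC
      by (subst card_Diff_subset) (auto simp: regular_closed_def)
    then show ?thesis by (rule card_1_singletonE) blast
  qed
  then obtain p where p: "\<And>v. v \<in> C \<Longrightarrow> C - {v} - nbhd G v = {p v}" by metis
  have inv: "p v \<in> C \<and> p v \<noteq> v \<and> p (p v) = v" if "v \<in> C" for v
  proof -
    have pv: "p v \<in> C" "p v \<noteq> v" "p v \<notin> nbhd G v" using p[OF that] by auto
    then have "v \<in> C - {p v} - nbhd G (p v)" using that nbhd_sym[of v "p v"] by auto
    then show ?thesis using pv p[OF pv(1)] by auto
  qed
  have nb: "nbhd G v = C - {v, p v}" if "v \<in> C" for v
    using that C nbhd_subset[of v] p[OF that] by (auto simp: regular_closed_def)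
  have arcs: "parcs G = {(u, v). u \<in> C \<and> v \<in> C \<and> v \<noteq> u \<and> v \<noteq> p u}"
  proof (rule Set.set_eqI)
    fix a :: "'a \<times> 'a"
    obtain u v where a: "a = (u, v)" by (cases a)
    show "a \<in> parcs G \<longleftrightarrow> a \<in> {(u, v). u \<in> C \<and> v \<in> C \<and> v \<noteq> u \<and> v \<noteq> p u}"
      unfolding a using nb[of u] isolated arc_fst_in_verts[of "(u, v)"]
      by (cases "u \<in> C") (auto simp: nbhd_def)
  qed
  note coord = fixpoint_free_involution_coordinates[OF finC inv]
  show "even k" using coord(1) cC by simp
  define t where "t = (k + 2) div 2"
  obtain g where g: "bij_betw g C ({..<t} \<times> {..<2::nat})"
    and fst: "\<And>u v. u \<in> C \<Longrightarrow> v \<in> C \<Longrightarrow> fst (g u) = fst (g v) \<longleftrightarrow> v = u \<or> v = p u"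
    using coord(2) cC by (auto simp: t_def)
  let ?H = "graph_complement (graph_copies t (complete_graph 2))"
  \<comment> \<open>Adjacency is expressed through first coordinates only, which by
    \<open>fst\<close> is the relation "neither equal nor matched by \<open>p\<close>" on
    \<open>C\<close>.\<close>
  have arcsH: "parcs ?H = {(a, b). a \<in> g ` C \<and> b \<in> g ` C \<and> fst a \<noteq> fst b}"
    using g by (auto simp: graph_complement_def graph_copies_def complete_graph_def bij_betw_def)
  have "digraph_iso (with_proj G)
    (with_proj (disjoint_union ?H (graph_copies m (complete_graph 1))))"
  proof (rule digraph_iso_disjoint_union_isolated[OF _ pair_finite_verts CV _ _ _ m])
    show "pair_wf_digraph G" by unfold_locales
    show "parcs G \<subseteq> C \<times> C" using arcs by auto
    show "bij_betw g C (pverts ?H)"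
      using g by (simp add: graph_complement_def graph_copies_def complete_graph_def)
    show "parcs ?H = map_prod g g ` parcs G"
      unfolding arcsH arcs using fst by (auto simp: image_iff) blast+
  qed
  then show "digraph_iso (with_proj G)
    (with_proj (disjoint_union (graph_complement (graph_copies ((k + 2) div 2) (complete_graph 2)))
      (graph_copies m (complete_graph 1))))" by (simp add: t_def)
qed

end

theorem theorem3p3:
  fixes G :: "'a pair_pre_digraph" and vs :: "'a list" and n \<gamma> :: nat and \<alpha> :: real
  assumes "pair_graph G"
    and "distinct vs" and "set vs = pverts G"
    and "card (pverts G) = n"
    and "domination_number G = \<gamma>"
    and "1 \<le> \<gamma>" and "\<gamma> \<le> n - 1"
    and "0 \<le> \<alpha>" and "\<alpha> < 1"
  shows "rho_alpha \<alpha> vs G \<le> real n - real \<gamma> \<and>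
    (rho_alpha \<alpha> vs G = real n - real \<gamma> \<longleftrightarrow>
      digraph_iso (with_proj G)
        (with_proj (disjoint_union (complete_graph (n - \<gamma> + 1))
                                   (graph_copies (\<gamma> - 1) (complete_graph 1)))) \<or>
      (\<gamma> \<ge> 2 \<and> even (n - \<gamma>) \<and>
       digraph_iso (with_proj G)
        (with_proj (disjoint_union
          (graph_complement (graph_copies ((n - \<gamma> + 2) div 2) (complete_graph 2)))
          (graph_copies (\<gamma> - 2) (complete_graph 1))))))"
    (is "_ \<and> (_ \<longleftrightarrow> ?K \<or> ?M)")
proof -
  interpret pair_graph G by fact
  define k where "k = n - \<gamma>"
  \<comment> \<open>From \<open>1 \<le> \<gamma>\<close> and \<open>\<gamma> \<le> n - 1\<close> it
    follows that \<open>\<gamma> < n\<close>, so none of the natural subtractions truncates.\<close>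
  have k: "k > 0" "n = k + \<gamma>" "real n - real \<gamma> = real k"
    using assms(6,7) by (auto simp: k_def)
  have ne: "pverts G \<noteq> {}" using assms(4) k by auto
  have deg: "card (nbhd G v) \<le> k" if "v \<in> pverts G" for v
    using degree_add_domination_number_le[OF that] assms(4,5) k(2) by simp
  note rho = rho_alpha_le_degree[OF assms(2,3) ne assms(9) deg]
  have wf: "pair_wf_digraph G" by unfold_locales
  \<comment> \<open>By \<open>rho\<close> the left side is equivalent to equality, so only graph
    theory remains.\<close>
  have "(\<exists>C. regular_closed G k C) \<longleftrightarrow> ?K \<or> ?M"
  proof
    assume "\<exists>C. regular_closed G k C"
    then obtain C where C: "regular_closed G k C" by blast
    have card: "card (pverts G) = k + domination_number G" using assms(4,5) k(2) by simp
    note isolated = regular_closed_structure(1)[OF C k(1) card]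
    have le: "card C \<le> n"
      using C pair_finite_verts assms(4) by (auto simp: regular_closed_def intro: card_mono)
    from regular_closed_structure(2)[OF C k(1) card] show "?K \<or> ?M"
    proof
      assume cC: "card C = k + 1"
      then have "card (pverts G) = card C + (\<gamma> - 1)" using assms(4,6) k(2) by simp
      from regular_closed_complete_iso[OF C isolated cC this] show ?thesis by (simp add: k_def)
    next
      assume cC: "card C = k + 2"
      \<comment> \<open>The \<open>k + 2\<close> vertices of \<open>C\<close> must fit into
        \<open>n = k + \<gamma>\<close>.\<close>
      then have "\<gamma> \<ge> 2" using le k(2) by simp
      moreover have "card (pverts G) = card C + (\<gamma> - 2)" using \<open>\<gamma> \<ge> 2\<close> cC assms(4) k(2) by simp
      note regular_closed_cocktail_party_iso[OF C isolated cC this]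
      ultimately show ?thesis by (simp add: k_def)
    qed
  next
    assume "?K \<or> ?M"
    then show "\<exists>C. regular_closed G k C"
    proof
      assume ?K
      moreover have "regular_closed (complete_graph (n - \<gamma> + 1)) k
          (pverts (complete_graph (n - \<gamma> + 1)))"
        unfolding regular_closed_def
        by (auto simp: pverts_complete_graph nbhd_complete_graph k_def)
      ultimately show ?thesis using disjoint_union_iso_regular_closed[OF wf] by blast
    next
      assume M: ?M
      define t where "t = (n - \<gamma> + 2) div 2"
      \<comment> \<open>Evenness makes the halving exact. Of the \<open>2 * t\<close> vertices each
        is non-adjacent to the two in its own copy, itself included, which gives degree
        \<open>k\<close>.\<close>
      have t: "t > 0" "2 * t - 2 = k" using M by (auto simp: t_def k_def)
      let ?H = "graph_complement (graph_copies t (complete_graph 2))"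
      have pv: "pverts ?H = {..<t} \<times> {..<2}"
        by (simp add: graph_complement_def graph_copies_def complete_graph_def)
      have "card ({..<t} \<times> {..<2::nat} - {i} \<times> {..<2}) = k" if "i < t" for i
        using that t by (subst card_Diff_subset) (auto simp: card_cartesian_product)
      then have "regular_closed ?H k (pverts ?H)"
        unfolding regular_closed_def pv using t(1) by (auto simp: nbhd_cocktail_party lessThan_empty_iff)
      then show ?thesis
        using disjoint_union_iso_regular_closed[OF wf] M unfolding t_def by blast
    qed
  qed
  then show ?thesis using rho k(3) by simp
qed

end
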